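(* Let $d_{\mathrm v}\ge 3$ and $d_{\mathrm c}\ge 2$ be integers and let $R\in(0,1]$ be the rate of a $(d_{\mathrm v},d_{\mathrm c})$-regular binary LDPC code. For $E_{\mathrm b}/N_0>0$ let $m_\lambda=4R\,E_{\mathrm b}/N_0$ and let $(m^{(l)})_{l\ge 0}$ be the sequence of check-node output means predicted by (Gaussian-approximation) density evolution, i.e. $m^{(0)}=0$ and, for $l\ge1$, $$m^{(l)}=\phi^{-1}\left(1-\left[1-\phi\left(m_\lambda+(d_{\mathrm v}-1)m^{(l-1)}\right)\right]^{d_{\mathrm c}-1}\right).$$ Then for every $E_{\mathrm b}/N_0$ above the decoding threshold and every real $r$ with $0\le r<d_{\mathrm v}-1$, the sequence $m^{(l)}$ asymptotically dominates $r^l$ after a finite number of iterations. That is, there exist a real $C>0$ and a finite iteration index $L\ge 1$ with $$m^{(l)}>C\,r^l\qquad\text{for all } l\ge L.$$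
   Context: Setting: a $(d_{\mathrm v},d_{\mathrm c})$-regular binary LDPC code (every variable node of the Tanner graph has degree $d_{\mathrm v}$, every check node degree $d_{\mathrm c}$) with binary antipodal signaling over the additive white Gaussian noise channel, decoded by the log-likelihood-ratio (LLR) domain sum-product algorithm without saturation. The channel quality is $E_{\mathrm b}/N_0$ (a positive real, on a linear scale), $R$ is the code rate, and the mean channel LLR is $m_\lambda=4R\,E_{\mathrm b}/N_0$. "Density evolution" means the consistent Gaussian approximation to density evolution, in which the mean $m^{(l)}$ of the check-node output LLR at iteration $l$ evolves by the recursion in the claim. The decoding threshold is the infimum of those values of $E_{\mathrm b}/N_0>0$ for which the density evolution recursion satisfies $m^{(l)}\to\infty$ as $l\to\infty$. The function $\phi:[0,\infty)\to(0,1]$ is $$\phi(x)=\begin{cases}1-\dfrac{1}{\sqrt{4\pi x}}\displaystyle\int_{\mathbb R}\tanh\frac u2\; e^{-\frac{(u-x)^2}{4x}}\,du,& x>0,\\[2mm] 1,& x=0.\end{cases}$$ It is continuous and strictly decreasing from $1$ (at $x=0$) to $0$ (as $x\to\infty$), and $\phi^{-1}:(0,1]\to[0,\infty)$ is its inverse. *)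

theory Defs
  imports "HOL-Analysis.Analysis" "HOL-Library.Z2"
begin

text \<open>
  A Tanner graph is given by its variable nodes \<open>V\<close>, its check nodes \<open>K\<close> and its edges
  \<open>E\<close>, which are the positions of the ones in the parity-check matrix.
\<close>

definition regular_tanner_graph ::
  "nat \<Rightarrow> nat \<Rightarrow> 'v set \<Rightarrow> 'c set \<Rightarrow> ('v \<times> 'c) set \<Rightarrow> bool" where
  "regular_tanner_graph dv dc V K E \<longleftrightarrow>
     finite V \<and> V \<noteq> {} \<and> finite K \<and> E \<subseteq> V \<times> K \<and>
     (\<forall>v\<in>V. card {c. (v, c) \<in> E} = dv) \<and>
     (\<forall>c\<in>K. card {v. (v, c) \<in> E} = dc)"

definition ldpc_code :: "'v set \<Rightarrow> 'c set \<Rightarrow> ('v \<times> 'c) set \<Rightarrow> ('v \<Rightarrow> bit) set" where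
  "ldpc_code V K E = {x \<in> V \<rightarrow>\<^sub>E UNIV. \<forall>c\<in>K. (\<Sum>v | (v, c) \<in> E. x v) = 0}"

text \<open>
  The actual rate (dimension over block length), not the design rate \<open>1 - dv / dc\<close>.
\<close>

definition ldpc_rate :: "'v set \<Rightarrow> 'c set \<Rightarrow> ('v \<times> 'c) set \<Rightarrow> real" where
  "ldpc_rate V K E = log 2 (real (card (ldpc_code V K E))) / real (card V)"

text \<open>Only the values of \<open>phi\<close> and \<open>phi_inv\<close> on \<open>{0..}\<close> and \<open>{0<..1}\<close> are meaningful.\<close>

definition phi :: "real \<Rightarrow> real" where
  "phi x = (if x > 0
     then 1 - 1 / sqrt (4 * pi * x) *
            (\<integral>u. tanh (u / 2) * exp (- ((u - x)\<^sup>2 / (4 * x))) \<partial>lborel)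
     else 1)"

definition phi_inv :: "real \<Rightarrow> real" where
  "phi_inv = inv_into {0..} phi"

definition mean_channel_llr :: "real \<Rightarrow> real \<Rightarrow> real" where
  "mean_channel_llr R EbN0 = 4 * R * EbN0"

primrec de_mean :: "nat \<Rightarrow> nat \<Rightarrow> real \<Rightarrow> nat \<Rightarrow> real" where
  "de_mean dv dc mlam 0 = 0"
| "de_mean dv dc mlam (Suc l) =
     phi_inv (1 - (1 - phi (mlam + (real dv - 1) * de_mean dv dc mlam l)) ^ (dc - 1))"

text \<open>
  The infimum is taken in the extended reals, so that it would be \<open>\<infinity>\<close> if the recursion
  diverged for no value of \<open>EbN0\<close>.
\<close>

definition decoding_threshold :: "nat \<Rightarrow> nat \<Rightarrow> real \<Rightarrow> ereal" where
  "decoding_threshold dv dc R =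
     Inf (ereal ` {EbN0. EbN0 > 0 \<and>
       filterlim (de_mean dv dc (mean_channel_llr R EbN0)) at_top sequentially})"

end

theory Submission
  imports Defs "HOL-Probability.Distributions"
begin

text \<open>
  Tilting the density of \<open>N(x, 2x)\<close> by \<open>exp (-u / 2)\<close> centres it, and rescaling \<open>u = sqrt x * t\<close> gives
  \<open>phi x = exp (-x / 4) * E [1 / cosh (sqrt x * T / 2)]\<close> with \<open>T\<close> distributed as \<open>N(0, 2)\<close>. The
  expectation is positive, continuous and decreasing in \<open>x\<close>, so \<open>phi\<close> is a decreasing bijection from
  \<open>[0, \<infinity>)\<close> onto \<open>(0, 1]\<close>, and \<open>phi (y - 4 ln k) \<ge> k * phi y\<close>. By Bernoulli's inequality one step of
  the recursion is therefore at least \<open>(dv - 1) m - 4 ln (dc - 1)\<close>. Above the threshold \<open>m\<close> diverges,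
  because the recursion is monotone in the channel parameter, so eventually each step multiplies \<open>m\<close>
  by at least \<open>r\<close>.
\<close>

section \<open>Gaussian expectation of the hyperbolic secant\<close>

definition sech_mean :: "real \<Rightarrow> real" where
  "sech_mean x = (\<integral>t. normal_density 0 (sqrt 2) t / cosh (t * sqrt x / 2) \<partial>lborel)"

lemma continuous_on_normal_density [continuous_intros]:
  "continuous_on A (normal_density \<mu> \<sigma>)"
  unfolding normal_density_def by (cases "\<sigma> = 0") (auto intro!: continuous_intros)

text \<open>Since \<open>cosh\<close> is at least 1, the normal density is a majorant uniform in
  \<open>c\<close>; it serves both integrability and dominated convergence.\<close>

lemma normal_density_div_cosh_le:
  "norm (normal_density \<mu> \<sigma> t / cosh c) \<le> normal_density \<mu> \<sigma> t"
  using divide_left_mono[OF cosh_real_ge_1 normal_density_nonneg, of c \<mu> \<sigma> t] by simp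

lemma sech_mean_integrable:
  "integrable lborel (\<lambda>t. normal_density 0 (sqrt 2) t / cosh (t * c))"
proof (rule Bochner_Integration.integrable_bound)
  show "integrable lborel (normal_density 0 (sqrt 2))"
    by (rule integrable_normal_density) simp
  show "(\<lambda>t. normal_density 0 (sqrt 2) t / cosh (t * c)) \<in> borel_measurable lborel"
    unfolding measurable_lborel2
    by (intro borel_measurable_continuous_onI continuous_intros) simp
  show "AE t in lborel. norm (normal_density 0 (sqrt 2) t / cosh (t * c))
      \<le> norm (normal_density 0 (sqrt 2) t)"
    using normal_density_div_cosh_le by (auto simp: normal_density_nonneg)
qed

lemma phi_eq_exp_sech_mean:
  assumes "x \<ge> 0"
  shows "phi x = exp (- x / 4) * sech_mean x"
proof (cases "x = 0")
  case True
  then show ?thesis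
    by (simp add: phi_def sech_mean_def integral_normal_density)
next
  case False
  with assms have x: "x > 0" by simp
  let ?N = "normal_density x (sqrt (2 * x))"
  have N: "?N u = 1 / sqrt (4 * pi * x) * exp (- ((u - x)\<^sup>2 / (4 * x)))" for u
    using x by (simp add: normal_density_def mult_ac)
  have intN: "integrable lborel ?N"
    using x by (intro integrable_normal_density) simp
  have intT: "integrable lborel (\<lambda>u. tanh (u / 2) * ?N u)"
  proof (rule Bochner_Integration.integrable_bound[OF intN])
    show "(\<lambda>u. tanh (u / 2) * ?N u) \<in> borel_measurable lborel"
      unfolding measurable_lborel2
      by (intro borel_measurable_continuous_onI continuous_intros)
        (auto simp: cosh_real_nonzero)
    have "\<bar>tanh (u / 2)\<bar> \<le> 1" for u :: real
      using tanh_real_bounds[of "u / 2"] by auto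
    then show "AE u in lborel. norm (tanh (u / 2) * ?N u) \<le> norm (?N u)"
      by (auto simp: abs_mult intro!: mult_left_le_one_le)
  qed
  have "phi x = 1 - (\<integral>u. tanh (u / 2) * ?N u \<partial>lborel)"
    using x unfolding phi_def N by (simp add: mult_ac flip: integral_mult_right_zero)
  also have "\<dots> = (\<integral>u. ?N u \<partial>lborel) - (\<integral>u. tanh (u / 2) * ?N u \<partial>lborel)"
    using x by (subst integral_normal_density) auto
  also have "\<dots> = (\<integral>u. ?N u - tanh (u / 2) * ?N u \<partial>lborel)"
    by (rule Bochner_Integration.integral_diff[OF intN intT, symmetric])
  also have "\<dots> = sqrt x * (\<integral>t. ?N (sqrt x * t) - tanh (sqrt x * t / 2) * ?N (sqrt x * t) \<partial>lborel)"
    using x lborel_integral_real_affine[of "sqrt x" "\<lambda>u. ?N u - tanh (u / 2) * ?N u" 0] by simp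
  also have "\<dots> = (\<integral>t. sqrt x * (?N (sqrt x * t) - tanh (sqrt x * t / 2) * ?N (sqrt x * t)) \<partial>lborel)"
    by simp
  also have "\<dots> = (\<integral>t. exp (- x / 4) * (normal_density 0 (sqrt 2) t / cosh (t * sqrt x / 2)) \<partial>lborel)"
  proof (rule Bochner_Integration.integral_cong[OF refl])
    fix t :: real
    define v where "v = t * sqrt x / 2"
    have sq: "sqrt x * t = 2 * v" by (simp add: v_def)
    have tanh: "1 - tanh v = exp (- v) / cosh v"
      by (simp add: tanh_def cosh_minus_sinh[symmetric] diff_divide_distrib)
    \<comment> \<open>The cross term \<open>- v\<close> is the tilt: the factor \<open>exp v\<close>
      it produces cancels the \<open>exp (- v)\<close> in \<open>1 - tanh v\<close>, leaving a
      centred Gaussian over \<open>cosh v\<close> and the constant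
      \<open>exp (- x / 4)\<close>.\<close>
    have "(2 * v - x)\<^sup>2 / (4 * x) = t\<^sup>2 / 4 - v + x / 4"
      using x by (simp add: v_def field_simps power2_eq_square)
    then have expo: "exp (- ((2 * v - x)\<^sup>2 / (4 * x))) = exp (- t\<^sup>2 / 4) * exp v * exp (- x / 4)"
      by (simp flip: exp_add)
    have "sqrt x * (?N (sqrt x * t) - tanh (sqrt x * t / 2) * ?N (sqrt x * t))
        = sqrt x * ?N (2 * v) * (1 - tanh v)"
      unfolding sq by (simp add: algebra_simps)
    also have "\<dots> = sqrt x / sqrt (4 * pi * x) * exp (- t\<^sup>2 / 4) * exp (- x / 4) / cosh v * (exp v * exp (- v))"
      unfolding N expo tanh by simp
    also have "\<dots> = exp (- x / 4) * (normal_density 0 (sqrt 2) t / cosh v)"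
      using x by (simp add: normal_density_def real_sqrt_mult flip: exp_add)
    finally show "sqrt x * (?N (sqrt x * t) - tanh (sqrt x * t / 2) * ?N (sqrt x * t))
        = exp (- x / 4) * (normal_density 0 (sqrt 2) t / cosh (t * sqrt x / 2))"
      by (simp add: v_def)
  qed
  also have "\<dots> = exp (- x / 4) * sech_mean x"
    unfolding sech_mean_def by (rule integral_mult_right_zero)
  finally show ?thesis .
qed

lemma sech_mean_pos: "sech_mean x > 0"
proof -
  let ?f = "\<lambda>t. normal_density 0 (sqrt 2) t / cosh (t * sqrt x / 2)"
  have int: "integrable lborel ?f"
    using sech_mean_integrable[of "sqrt x / 2"] by simp
  have pos: "?f t > 0" for t
    by (intro divide_pos_pos normal_density_pos) auto
  \<comment> \<open>A nonnegative integrand with zero integral vanishes almost everywhere, but this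
    one vanishes nowhere and Lebesgue measure is not null.\<close>
  have "sech_mean x \<noteq> 0"
  proof
    assume "sech_mean x = 0"
    then have "AE t in lborel. ?f t = 0"
      using integral_nonneg_eq_0_iff_AE[OF int] pos by (simp add: sech_mean_def less_imp_le)
    then have "AE t::real in lborel. False"
      by (rule eventually_mono) (use pos in \<open>simp add: less_le\<close>)
    then show False
      by (simp add: eventually_False ae_filter_eq_bot_iff)
  qed
  moreover have "sech_mean x \<ge> 0"
    unfolding sech_mean_def using pos by (intro integral_nonneg_AE) (simp add: less_imp_le)
  ultimately show ?thesis by simp
qed

lemma sech_mean_antimono:
  assumes "0 \<le> x" "x \<le> y"
  shows "sech_mean y \<le> sech_mean x"
  unfolding sech_mean_def
proof (rule integral_mono)
  fix t :: real
  \<comment> \<open>\<open>cosh\<close> is increasing only on the nonnegative reals and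
    \<open>t\<close> may be negative, so absolute values are compared.\<close>
  have "cosh (t * sqrt x / 2) \<le> cosh (t * sqrt y / 2)"
    using assms cosh_real_nonneg_le_iff[of "\<bar>t * sqrt x / 2\<bar>" "\<bar>t * sqrt y / 2\<bar>"]
    by (simp only: abs_ge_zero cosh_real_abs) (simp add: abs_mult mult_left_mono)
  then show "normal_density 0 (sqrt 2) t / cosh (t * sqrt y / 2)
      \<le> normal_density 0 (sqrt 2) t / cosh (t * sqrt x / 2)"
    by (intro divide_left_mono) auto
qed (use sech_mean_integrable[of "sqrt x / 2"] sech_mean_integrable[of "sqrt y / 2"] in simp_all)

lemma continuous_on_sech_mean: "continuous_on {0..} sech_mean"
  unfolding continuous_on_sequentially
proof (intro allI impI ballI, elim conjE)
  fix s :: "nat \<Rightarrow> real" and a :: real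
  assume lim: "s \<longlonglongrightarrow> a"
  show "(sech_mean \<circ> s) \<longlonglongrightarrow> sech_mean a"
    unfolding o_def sech_mean_def
  proof (rule integral_dominated_convergence)
    show "integrable lborel (normal_density 0 (sqrt 2))"
      by (rule integrable_normal_density) simp
    show "AE t in lborel. (\<lambda>i. normal_density 0 (sqrt 2) t / cosh (t * sqrt (s i) / 2))
        \<longlonglongrightarrow> normal_density 0 (sqrt 2) t / cosh (t * sqrt a / 2)"
      using lim by (intro AE_I2 tendsto_intros) auto
  qed (use sech_mean_integrable[of "sqrt _ / 2"] normal_density_div_cosh_le in \<open>auto dest: borel_measurable_integrable\<close>)
qed

section \<open>The decreasing bijection \<open>phi\<close> and its inverse\<close>

lemma phi_0: "phi 0 = 1"
  by (simp add: phi_def)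

lemma phi_pos: "x \<ge> 0 \<Longrightarrow> phi x > 0"
  by (simp add: phi_eq_exp_sech_mean sech_mean_pos)

text \<open>The prefactor \<open>exp (- x / 4)\<close> alone accounts for the decay, and the
  monotonicity of \<open>sech_mean\<close> can only strengthen it. This one estimate yields strict
  monotonicity, smallness of \<open>phi\<close> for the intermediate value argument, and the bound
  on a check update.\<close>

lemma phi_exp_le:
  assumes "0 \<le> x" "x \<le> y"
  shows "exp ((y - x) / 4) * phi y \<le> phi x"
proof -
  have "exp ((y - x) / 4) * phi y = exp (- x / 4) * sech_mean y"
    using assms by (simp add: phi_eq_exp_sech_mean diff_divide_distrib flip: exp_add mult.assoc)
  also have "\<dots> \<le> phi x"
    using assms by (simp add: phi_eq_exp_sech_mean sech_mean_antimono)
  finally show ?thesis .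
qed

lemma phi_strict_antimono:
  assumes "0 \<le> x" "x < y"
  shows "phi y < phi x"
proof -
  have "1 * phi y < exp ((y - x) / 4) * phi y"
    using assms by (intro mult_strict_right_mono phi_pos) auto
  with phi_exp_le[of x y] assms show ?thesis by simp
qed

lemma phi_less_iff:
  assumes "0 \<le> x" "0 \<le> y"
  shows "phi x < phi y \<longleftrightarrow> y < x"
  using phi_strict_antimono[of x y] phi_strict_antimono[of y x] assms
  by (cases x y rule: linorder_cases) auto

lemma phi_le_iff:
  assumes "0 \<le> x" "0 \<le> y"
  shows "phi x \<le> phi y \<longleftrightarrow> y \<le> x"
  using phi_less_iff[of y x] assms by (simp add: not_less[symmetric])

lemma phi_le_1: "x \<ge> 0 \<Longrightarrow> phi x \<le> 1"
  using phi_le_iff[of x 0] by (simp add: phi_0)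

lemma phi_surj:
  assumes "0 < p" "p \<le> 1"
  shows "p \<in> phi ` {0..}"
proof -
  \<comment> \<open>Chosen so that \<open>exp (- b / 4) = p\<close>, which bounds
    \<open>phi b\<close> by \<open>p * phi 0 = p\<close>.\<close>
  define b where "b = - 4 * ln p"
  have b: "b \<ge> 0"
    using assms by (simp add: b_def)
  have "phi b \<le> p"
    using phi_exp_le[of 0 b] b assms by (simp add: phi_0 b_def exp_minus field_simps)
  moreover have "continuous_on {0..b} phi"
  proof (rule continuous_on_eq)
    show "continuous_on {0..b} (\<lambda>x. exp (- x / 4) * sech_mean x)"
      by (intro continuous_intros continuous_on_subset[OF continuous_on_sech_mean]) auto
  qed (simp add: phi_eq_exp_sech_mean)
  ultimately obtain x where "0 \<le> x" "phi x = p"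
    using IVT2'[of phi b p 0] b assms by (auto simp: phi_0)
  then show ?thesis by auto
qed

lemma phi_inv_nonneg: "0 < p \<Longrightarrow> p \<le> 1 \<Longrightarrow> phi_inv p \<ge> 0"
  using inv_into_into[OF phi_surj, of p] by (simp add: phi_inv_def)

lemma phi_phi_inv: "0 < p \<Longrightarrow> p \<le> 1 \<Longrightarrow> phi (phi_inv p) = p"
  using f_inv_into_f[OF phi_surj, of p] by (simp add: phi_inv_def)

text \<open>Reduces inequalities about \<open>phi_inv\<close> to inequalities about
  \<open>phi\<close>, reversing the order.\<close>

lemma le_phi_inv_iff:
  assumes "0 < p" "p \<le> 1" "0 \<le> x"
  shows "x \<le> phi_inv p \<longleftrightarrow> p \<le> phi x"
  using phi_le_iff[of "phi_inv p" x] assms by (simp add: phi_phi_inv phi_inv_nonneg)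

section \<open>The check-node update\<close>

definition check_update :: "nat \<Rightarrow> real \<Rightarrow> real" where
  "check_update k y = phi_inv (1 - (1 - phi y) ^ k)"

text \<open>Keeps the argument in the interval where \<open>phi_inv\<close> inverts
  \<open>phi\<close>; for \<open>k = 0\<close> the argument would be 0.\<close>

lemma check_update_arg_bounds:
  assumes "k \<ge> 1" "y \<ge> 0"
  shows "0 < 1 - (1 - phi y) ^ k" "1 - (1 - phi y) ^ k \<le> 1"
  using phi_pos[of y] phi_le_1[of y] assms power_less_one_iff[of "1 - phi y" k] by auto

lemma check_update_nonneg: "k \<ge> 1 \<Longrightarrow> y \<ge> 0 \<Longrightarrow> check_update k y \<ge> 0"
  unfolding check_update_def by (intro phi_inv_nonneg check_update_arg_bounds)

lemma check_update_mono:
  assumes "k \<ge> 1" "0 \<le> x" "x \<le> y"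
  shows "check_update k x \<le> check_update k y"
proof -
  have "(1 - phi x) ^ k \<le> (1 - phi y) ^ k"
    using assms phi_le_1[of x] by (intro power_mono) (auto simp: phi_le_iff)
  also have "1 - (1 - phi x) ^ k = phi (check_update k x)"
    unfolding check_update_def
    using assms by (intro phi_phi_inv[symmetric] check_update_arg_bounds) auto
  ultimately show ?thesis
    unfolding check_update_def[of k y] using assms
    by (subst le_phi_inv_iff[OF check_update_arg_bounds check_update_nonneg]) auto
qed

lemma check_update_lower:
  assumes "k \<ge> 1" "y \<ge> 4 * ln (real k)"
  shows "check_update k y \<ge> y - 4 * ln (real k)"
proof -
  have y: "y \<ge> 0"
    using assms ln_ge_zero[of "real k"] by linarith
  have "1 - (1 - phi y) ^ k \<le> real k * phi y"
    using Bernoulli_inequality[of "- phi y" k] phi_le_1[of y] y by simp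
  \<comment> \<open>The factor \<open>k\<close> becomes a shift by \<open>4 * ln k\<close>; the
    lower bound on \<open>y\<close> keeps the shifted point nonnegative.\<close>
  also have "\<dots> = exp ((y - (y - 4 * ln (real k))) / 4) * phi y"
    using assms by simp
  also have "\<dots> \<le> phi (y - 4 * ln (real k))"
    using assms by (intro phi_exp_le) auto
  finally show ?thesis
    unfolding check_update_def using assms y
    by (subst le_phi_inv_iff[OF check_update_arg_bounds]) auto
qed

section \<open>Density evolution and the threshold\<close>

lemma de_mean_Suc:
  "de_mean dv dc mlam (Suc l)
     = check_update (dc - 1) (mlam + (real dv - 1) * de_mean dv dc mlam l)"
  by (simp add: check_update_def)

declare de_mean.simps(2) [simp del]

lemma de_mean_nonneg:
  assumes "dv \<ge> 1" "dc \<ge> 2" "mlam \<ge> 0"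
  shows "de_mean dv dc mlam l \<ge> 0"
  by (induction l) (use assms in \<open>auto simp: de_mean_Suc intro!: check_update_nonneg\<close>)

lemma de_mean_mono:
  assumes "dv \<ge> 1" "dc \<ge> 2" "0 \<le> a" "a \<le> b"
  shows "de_mean dv dc a l \<le> de_mean dv dc b l"
proof (induction l)
  case (Suc l)
  then show ?case
    unfolding de_mean_Suc using assms
    by (intro check_update_mono add_mono mult_left_mono add_nonneg_nonneg mult_nonneg_nonneg
        de_mean_nonneg) auto
qed simp

lemma filterlim_de_mean_above_threshold:
  assumes "dv \<ge> 1" "dc \<ge> 2" "R > 0" "ereal EbN0 > decoding_threshold dv dc R"
  shows "filterlim (de_mean dv dc (mean_channel_llr R EbN0)) at_top sequentially"
proof -
  \<comment> \<open>Exceeding the infimum only provides some diverging value below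
    \<open>EbN0\<close>; monotonicity then carries divergence up to \<open>EbN0\<close>.\<close>
  obtain e where e: "e > 0" "e < EbN0"
    "filterlim (de_mean dv dc (mean_channel_llr R e)) at_top sequentially"
    using assms(4) by (auto simp: decoding_threshold_def Inf_less_iff)
  show ?thesis
    using e assms
    by (intro filterlim_at_top_mono[OF e(3)] always_eventually allI de_mean_mono)
      (auto simp: mean_channel_llr_def)
qed

theorem corollary4:
  fixes dv dc :: nat and R EbN0 r :: real
    and V :: "'v set" and K :: "'c set" and E :: "('v \<times> 'c) set"
  assumes "dv \<ge> 3" and "dc \<ge> 2"
    and "regular_tanner_graph dv dc V K E"
    and "R = ldpc_rate V K E"
    and "0 < R" and "R \<le> 1"
    and "EbN0 > 0"
    and "ereal EbN0 > decoding_threshold dv dc R"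
    and "0 \<le> r" and "r < real dv - 1"
  shows "\<exists>C>0. \<exists>L\<ge>1. \<forall>l\<ge>L. de_mean dv dc (mean_channel_llr R EbN0) l > C * r ^ l"
proof -
  define lam where "lam = mean_channel_llr R EbN0"
  define m where "m = de_mean dv dc lam"
  define a where "a = 4 * ln (real (dc - 1))"
  \<comment> \<open>Once \<open>m l\<close> reaches the second entry, the surplus
    \<open>(dv - 1 - r) * m l\<close> pays for the loss \<open>a\<close> of a step. The entry 1
    starts the induction for \<open>growth\<close> at \<open>r ^ 0\<close>.\<close>
  define B where "B = max 1 (a / (real dv - 1 - r))"
  have lam: "lam \<ge> 0"
    using assms by (simp add: lam_def mean_channel_llr_def)
  have "filterlim m at_top sequentially"
    using filterlim_de_mean_above_threshold[of dv dc R EbN0] assms by (simp add: m_def lam_def)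
  then obtain L0 where L0: "m l \<ge> B" if "l \<ge> L0" for l
    by (auto simp: filterlim_at_top eventually_sequentially)
  define L where "L = max 1 L0"
  have step: "m (Suc l) \<ge> r * m l" if "l \<ge> L" for l
  proof -
    have ml: "m l \<ge> 1" "a / (real dv - 1 - r) \<le> m l"
      using L0[of l] that by (auto simp: L_def B_def)
    have "a \<le> (real dv - 1 - r) * m l"
      using ml(2) assms by (simp add: divide_le_eq mult.commute)
    then have *: "r * m l \<le> lam + (real dv - 1) * m l - a"
      using lam by (simp add: algebra_simps)
    have "r * m l \<ge> 0"
      using ml assms by simp
    with * have "lam + (real dv - 1) * m l \<ge> a" by linarith
    then have "lam + (real dv - 1) * m l - a \<le> m (Suc l)"
      using check_update_lower[of "dc - 1" "lam + (real dv - 1) * m l"] assms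
      by (simp add: m_def de_mean_Suc a_def)
    with * show ?thesis by linarith
  qed
  have growth: "m (L + n) \<ge> r ^ n" for n
  proof (induction n)
    case 0
    then show ?case using L0[of L] by (simp add: L_def B_def)
  next
    case (Suc n)
    have "r ^ Suc n \<le> r * m (L + n)"
      using Suc assms by (simp add: mult_left_mono)
    with step[of "L + n"] show ?case by simp
  qed
  \<comment> \<open>Growth is counted from \<open>L\<close>, so \<open>C\<close> must absorb
    \<open>r ^ L\<close>. Using \<open>r + 1\<close> avoids division by zero when
    \<open>r = 0\<close>, and the factor 2 makes the inequality strict.\<close>
  define C where "C = 1 / (2 * (r + 1) ^ L)"
  have C: "C > 0" using assms by (simp add: C_def)
  have "C * r ^ l < m l" if "l \<ge> L" for l
  proof -
    obtain n where n: "l = L + n"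
      using \<open>l \<ge> L\<close> le_Suc_ex by blast
    have "r ^ L \<le> (r + 1) ^ L"
      using assms by (intro power_mono) auto
    then have "C * r ^ L \<le> 1 / 2"
      using assms by (simp add: C_def field_simps)
    then have "C * r ^ L * r ^ n \<le> 1 / 2 * m l"
      using growth[of n] assms n by (intro mult_mono) auto
    moreover have "m l > 0"
      using L0[of l] that by (simp add: L_def B_def)
    ultimately show ?thesis
      by (simp add: n power_add mult.assoc)
  qed
  moreover have "L \<ge> 1" by (simp add: L_def)
  ultimately show ?thesis
    using C by (auto simp: m_def lam_def)
qed

end
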